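(* Let $\partial\Omega$ be tangent-cone graph-like with radius $r>0$ and let $s\in[0,L)$ be such that $\partial\Omega$ is tangentially graph-like at $\gamma(s)$ with radius $r$. Then $\frac{\partial}{\partial r}g(s,r)$ exists and $\frac{\partial}{\partial r}g(s,r)=(\theta_2-\theta_1)r$, which is the length of the curve $C(\gamma(s),r)\cap\Omega$.
   Context: $\Omega\subset\mathbb R^2$ is compact with simple closed, piecewise continuously differentiable boundary $\partial\Omega$ of length $L$; $\gamma:[0,L]\to\partial\Omega$ is a continuous counterclockwise arclength parameterization, $\gamma(0)=\gamma(L)$. $D(p,r)$ and $C(p,r)$ are the closed disk and circle of radius $r$ about $p$; $g(s,r)=\operatorname{Area}(\Omega\cap D(\gamma(s),r))$. Tangent cone: $T_\gamma(s)=\{\alpha\Gamma^-+\beta\Gamma^+:\alpha,\beta\ge0,\alpha+\beta>0\}$ with $\Gamma^\mp$ the left/right limits of $\gamma'$ at $s$ (periodic extension). $\partial\Omega$ is tangent-cone graph-like with radius $r$ if for every $p=\gamma(s)\in\partial\Omega$, every $w\in T_\gamma(s)$ and all distinct $u,v\in\partial\Omega\cap D(p,r)$, $\langle w,u-v\rangle\ne0$. $\partial\Omega$ is tangentially graph-like (TGL) at $p$ with radius $r$ if $\partial\Omega$ is continuously differentiable and there is a Cartesian coordinate system with origin $p$ in which $\partial\Omega\cap D(p,r)$ is the graph of a function $f$ with $f(0)=0$, $f'(0)=0$; coordinates are oriented so that the interior of $\Omega$ is "up", i.e. $(0,\epsilon)\in\Omega$ for small $\epsilon>0$. In these coordinates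 at $p=\gamma(s)$, $\partial\Omega$ meets $C(\gamma(s),r)$ in exactly two points, one on the right and one on the left; $\theta_1\in(-\frac\pi2,\frac\pi2)$ and $\theta_2\in(\frac\pi2,\frac{3\pi}2)$ are the angles with the positive $x$-axis of the rays from the origin to the right and left points respectively. *)

theory Defs
  imports "HOL-Complex_Analysis.Complex_Analysis"
begin

text \<open>
  The Euclidean plane is \<open>complex\<close>, with its inner product \<open>\<bullet>\<close> and Lebesgue measure.
\<close>

definition periodic_ext :: "real \<Rightarrow> (real \<Rightarrow> complex) \<Rightarrow> real \<Rightarrow> complex"
  where "periodic_ext L \<gamma> t = \<gamma> (L * frac (t / L))"

abbreviation velocity :: "real \<Rightarrow> (real \<Rightarrow> complex) \<Rightarrow> real \<Rightarrow> complex"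
  where "velocity L \<gamma> t \<equiv> vector_derivative (periodic_ext L \<gamma>) (at t)"

text \<open>
  The library predicate \<open>piecewise_C1_differentiable_on\<close> asks for a continuous derivative only off
  a finite set; the one-sided limits of the derivative, which make the pieces \<open>C\<^sup>1\<close> up to their
  end points, are required separately.
  Only the values of \<open>\<gamma>\<close> on \<open>{0..L}\<close> matter, since \<open>0\<close> and \<open>L\<close> may be put in the exceptional set.
  The unit speed makes \<open>L\<close> the length of the boundary.
\<close>

definition arclength_boundary_param :: "complex set \<Rightarrow> real \<Rightarrow> (real \<Rightarrow> complex) \<Rightarrow> bool"
  where "arclength_boundary_param \<Omega> L \<gamma> \<longleftrightarrow>
    L > 0 \<and>
    continuous_on {0..L} \<gamma> \<and> \<gamma> ` {0..L} = frontier \<Omega> \<and>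
    \<gamma> 0 = \<gamma> L \<and> inj_on \<gamma> {0..<L} \<and>
    \<gamma> piecewise_C1_differentiable_on {0..L} \<and>
    (\<forall>t. (\<exists>l. (velocity L \<gamma> \<longlongrightarrow> l) (at_left t)) \<and> (\<exists>l. (velocity L \<gamma> \<longlongrightarrow> l) (at_right t))) \<and>
    (\<forall>t\<in>{0<..<L}. \<gamma> differentiable (at t) \<longrightarrow> norm (vector_derivative \<gamma> (at t)) = 1) \<and>
    (\<forall>z\<in>inside (frontier \<Omega>). winding_number (\<lambda>t. \<gamma> (L * t)) z = 1)"

definition C1_boundary_param :: "real \<Rightarrow> (real \<Rightarrow> complex) \<Rightarrow> bool"
  where "C1_boundary_param L \<gamma> \<longleftrightarrow> periodic_ext L \<gamma> C1_differentiable_on UNIV"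

definition disk_area :: "complex set \<Rightarrow> (real \<Rightarrow> complex) \<Rightarrow> real \<Rightarrow> real \<Rightarrow> real"
  where "disk_area \<Omega> \<gamma> s r = measure lebesgue (\<Omega> \<inter> cball (\<gamma> s) r)"

definition tangent_cone :: "real \<Rightarrow> (real \<Rightarrow> complex) \<Rightarrow> real \<Rightarrow> complex set"
  where "tangent_cone L \<gamma> s =
    {\<alpha> *\<^sub>R Lim (at_left s) (velocity L \<gamma>) + \<beta> *\<^sub>R Lim (at_right s) (velocity L \<gamma>) | \<alpha> \<beta>.
      \<alpha> \<ge> 0 \<and> \<beta> \<ge> 0 \<and> \<alpha> + \<beta> > 0}"

definition tangent_cone_graph_like ::
    "complex set \<Rightarrow> real \<Rightarrow> (real \<Rightarrow> complex) \<Rightarrow> real \<Rightarrow> bool"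
  where "tangent_cone_graph_like \<Omega> L \<gamma> r \<longleftrightarrow>
    (\<forall>s\<in>{0..<L}. \<forall>w\<in>tangent_cone L \<gamma> s.
      \<forall>u\<in>frontier \<Omega> \<inter> cball (\<gamma> s) r. \<forall>v\<in>frontier \<Omega> \<inter> cball (\<gamma> s) r.
        u \<noteq> v \<longrightarrow> w \<bullet> (u - v) \<noteq> 0)"

text \<open>
  A unit vector \<open>e\<close> encodes the right-handed Cartesian coordinate system with origin \<open>p\<close> whose
  \<open>x\<close>-axis points along \<open>e\<close>: the point with coordinates \<open>(x, y)\<close> is \<open>p + e * Complex x y\<close>.
  The domain of the graph function is some set \<open>A\<close> of abscissae.  When the boundary is a simple
  closed curve and \<open>r > 0\<close>, \<open>A\<close> is automatically a neighbourhood of \<open>0\<close>, so that the derivative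
  within \<open>A\<close> is the ordinary one.  The last conjunct says that \<open>\<Omega>\<close> lies above the origin.
\<close>

definition graph_coords :: "complex set \<Rightarrow> complex \<Rightarrow> real \<Rightarrow> complex \<Rightarrow> bool"
  where "graph_coords \<Omega> p r e \<longleftrightarrow>
    norm e = 1 \<and>
    (\<exists>A f. 0 \<in> A \<and> f 0 = 0 \<and> (f has_real_derivative 0) (at 0 within A) \<and>
       frontier \<Omega> \<inter> cball p r = {p + e * Complex x (f x) | x. x \<in> A}) \<and>
    (\<forall>\<^sub>F \<epsilon> in at_right 0. p + e * Complex 0 \<epsilon> \<in> \<Omega>)"

definition tangentially_graph_like ::
    "complex set \<Rightarrow> real \<Rightarrow> (real \<Rightarrow> complex) \<Rightarrow> complex \<Rightarrow> real \<Rightarrow> bool"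
  where "tangentially_graph_like \<Omega> L \<gamma> p r \<longleftrightarrow>
    C1_boundary_param L \<gamma> \<and> (\<exists>e. graph_coords \<Omega> p r e)"

text \<open>
  The set \<open>A\<close> is a simple arc of length \<open>l\<close>, the length being the integral of the speed of an
  injective piecewise \<open>C\<^sup>1\<close> parameterization (it does not depend on which one).
\<close>

definition has_curve_length :: "complex set \<Rightarrow> real \<Rightarrow> bool"
  where "has_curve_length A l \<longleftrightarrow>
    (\<exists>c. arc c \<and> valid_path c \<and> path_image c = A \<and>
       ((\<lambda>t. norm (vector_derivative c (at t))) has_integral l) {0..1})"

end

theory Submission imports Defs begin

text \<open>
  The tangent-cone condition, applied at a boundary point \<open>q \<noteq> \<gamma> s\<close> of the disk, says that the
  distance to \<open>\<gamma> s\<close> is not stationary at \<open>q\<close> along the boundary.  Hence the boundary leaves the disk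
  once and returns once, so it meets the circle in exactly two points; the abscissa is injective
  along the boundary arc in the disk, so one of them lies on each side of \<open>\<gamma> s\<close>.  Neither open arc of
  the circle between them meets the boundary, and each contains an end of the vertical diameter:
  the upper end lies in \<open>\<Omega>\<close>, the lower one does not.  For radii close to \<open>r\<close>, the part of \<open>\<Omega>\<close> in a
  thin annulus is therefore squeezed between two annular sectors whose angles are close to
  \<open>\<theta>2 - \<theta>1\<close>.
\<close>

subsection \<open>Rotation invariance of Lebesgue measure\<close>

lemma nn_integral_lborel_shift:
  fixes g :: "'a::euclidean_space \<Rightarrow> ennreal"
  assumes [measurable]: "g \<in> borel_measurable borel"
  shows "(\<integral>\<^sup>+x. g (x + c) \<partial>lborel) = (\<integral>\<^sup>+x. g x \<partial>lborel)"
proof -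
  have "(\<integral>\<^sup>+x. g x \<partial>lborel) = (\<integral>\<^sup>+x. g x \<partial>distr lborel borel ((+) c))"
    by (simp add: lborel_distr_plus)
  also have "\<dots> = (\<integral>\<^sup>+x. g (x + c) \<partial>lborel)"
    by (subst nn_integral_distr) (auto simp: add.commute)
  finally show ?thesis ..
qed

lemma nn_integral_lborel_reflect:
  fixes g :: "'a::euclidean_space \<Rightarrow> ennreal"
  assumes [measurable]: "g \<in> borel_measurable borel"
  shows "(\<integral>\<^sup>+x. g (c - x) \<partial>lborel) = (\<integral>\<^sup>+x. g x \<partial>lborel)"
proof -
  have "lborel = distr lborel borel (\<lambda>x::'a. c - x)"
    using lborel_affine[of "-1" c] by (simp add: density_1)
  then have "(\<integral>\<^sup>+x. g x \<partial>lborel) = (\<integral>\<^sup>+x. g x \<partial>distr lborel borel (\<lambda>x. c - x))"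
    by simp
  also have "\<dots> = (\<integral>\<^sup>+x. g (c - x) \<partial>lborel)"
    by (subst nn_integral_distr) auto
  finally show ?thesis ..
qed

text \<open>
  The measure \<open>A \<mapsto> \<lambda> (f -` A)\<close> is translation invariant.  Exchanging integrals as in the proof
  that Haar measure is unique shows that it is proportional to Lebesgue measure, and the unit ball
  fixes the factor.
\<close>
lemma emeasure_orthogonal_vimage:
  fixes f :: "'a::euclidean_space \<Rightarrow> 'a"
  assumes f: "orthogonal_transformation f" and [measurable]: "A \<in> sets borel"
  shows "emeasure lborel (f -` A) = emeasure lborel A"
proof -
  have lin: "linear f"
    using f by (rule orthogonal_transformation_linear)
  have "continuous_on UNIV f"
    using lin by (simp add: linear_continuous_on linear_linear)
  then have [measurable]: "f \<in> borel_measurable borel"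
    by (rule borel_measurable_continuous_onI)
  define B where "B = ball (0::'a) 1"
  have [measurable]: "B \<in> sets borel"
    by (simp add: B_def)
  have fB: "f -` B = B"
    using orthogonal_transformation_norm[OF f] by (auto simp: B_def)
  have vim: "f -` A \<in> sets borel"
    using measurable_sets[OF \<open>f \<in> borel_measurable borel\<close> \<open>A \<in> sets borel\<close>] by simp
  have "emeasure lborel (f -` A) * emeasure lborel B
      = (\<integral>\<^sup>+x. indicator A (f x) * (\<integral>\<^sup>+y. indicator B y \<partial>lborel) \<partial>lborel)"
    by (subst nn_integral_multc) (auto simp: vim nn_integral_indicator simp flip: indicator_vimage)
  \<comment> \<open>Translating the inner variable by \<open>f x\<close> is free and couples the two
    integrals.\<close>
  also have "\<dots> = (\<integral>\<^sup>+x. indicator A (f x) * (\<integral>\<^sup>+y. indicator B (y + f x) \<partial>lborel) \<partial>lborel)"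
    by (subst nn_integral_lborel_shift) auto
  also have "\<dots> = (\<integral>\<^sup>+x. (\<integral>\<^sup>+y. indicator A (f x) * indicator B (y + f x) \<partial>lborel) \<partial>lborel)"
    by (subst nn_integral_cmult) auto
  also have "\<dots> = (\<integral>\<^sup>+y. (\<integral>\<^sup>+x. indicator A (f x) * indicator B (y + f x) \<partial>lborel) \<partial>lborel)"
    by (rule lborel_pair.Fubini') measurable
  also have "\<dots> = (\<integral>\<^sup>+y. (\<integral>\<^sup>+x. indicator A (f x - y) * indicator B (f x) \<partial>lborel) \<partial>lborel)"
  proof (rule nn_integral_cong)
    \<comment> \<open>For fixed \<open>y\<close>, the shift of \<open>x\<close> by a preimage
      \<open>c\<close> of \<open>- y\<close> moves \<open>y\<close> from the factor with
      \<open>B\<close> to the factor with \<open>A\<close>.\<close>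
    fix y
    obtain c where c: "f c = - y"
      using orthogonal_transformation_surj[OF f] by (metis surjD)
    show "(\<integral>\<^sup>+x. indicator A (f x) * indicator B (y + f x) \<partial>lborel)
        = (\<integral>\<^sup>+x. indicator A (f x - y) * indicator B (f x) \<partial>lborel)"
      by (subst nn_integral_lborel_shift[symmetric, where c = c]) (auto simp: linear_add[OF lin] c)
  qed
  also have "\<dots> = (\<integral>\<^sup>+x. (\<integral>\<^sup>+y. indicator A (f x - y) * indicator B (f x) \<partial>lborel) \<partial>lborel)"
    by (rule lborel_pair.Fubini') measurable
  also have "\<dots> = (\<integral>\<^sup>+x. (\<integral>\<^sup>+y. indicator A (f x - y) \<partial>lborel) * indicator B (f x) \<partial>lborel)"
    by (subst nn_integral_multc) auto
  also have "\<dots> = (\<integral>\<^sup>+x. (\<integral>\<^sup>+y. indicator A y \<partial>lborel) * indicator B (f x) \<partial>lborel)"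
    by (subst nn_integral_lborel_reflect) auto
  also have "\<dots> = emeasure lborel A * emeasure lborel B"
    by (subst nn_integral_cmult) (auto simp: fB nn_integral_indicator simp flip: indicator_vimage)
  finally have eq: "emeasure lborel (f -` A) * emeasure lborel B = emeasure lborel A * emeasure lborel B" .
  \<comment> \<open>The common factor can be cancelled only because it is neither zero nor
    infinite.\<close>
  have "emeasure lborel B = ennreal (unit_ball_vol DIM('a))"
    by (simp add: B_def emeasure_ball)
  moreover have "unit_ball_vol DIM('a) > 0"
    by simp
  ultimately have "emeasure lborel B \<noteq> 0" "emeasure lborel B \<noteq> \<infinity>"
    by (simp_all only: ennreal_neq_top infinity_ennreal_def ennreal_eq_0_iff not_le simp_thms)
  with eq show ?thesis
    by (metis ennreal_mult_divide_eq infinity_ennreal_def)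
qed

subsection \<open>Area of annular sectors\<close>

text \<open>For \<open>norm e = 1\<close>, multiplication by \<open>e\<close> is inverse to
  multiplication by \<open>cnj e\<close>, so the image of \<open>S\<close> is a preimage under an
  orthogonal map. Compactness makes both sets Borel.\<close>

lemma measure_rotation:
  fixes e :: complex
  assumes e: "norm e = 1" and S: "compact S"
  shows "measure lebesgue ((*) e ` S) = measure lebesgue S"
proof -
  define f where "f = (\<lambda>z. cnj e * z)"
  have "orthogonal_transformation f"
    unfolding orthogonal_transformation f_def
    by (auto simp: e norm_mult intro!: bounded_linear.linear bounded_linear_mult_right)
  moreover have "(*) e ` S = f -` S"
  proof (intro set_eqI iffI)
    have ce: "cnj e * (e * z) = z" "e * (cnj e * z) = z" for z
      using e complex_norm_square[of e] by (simp_all add: mult.assoc[symmetric] mult.commute[of "cnj e" e])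
    fix z
    show "z \<in> f -` S" if "z \<in> (*) e ` S"
      using that by (auto simp only: f_def vimage_eq ce elim!: imageE)
    show "z \<in> (*) e ` S" if "z \<in> f -` S"
    proof (rule image_eqI)
      show "z = e * f z"
        by (simp only: f_def ce)
    qed (use that in simp)
  qed
  ultimately have "emeasure lborel ((*) e ` S) = emeasure lborel S"
    using S emeasure_orthogonal_vimage[of f S] by (auto simp: borel_compact)
  moreover have "compact ((*) e ` S)"
    using S by (intro compact_continuous_image continuous_intros)
  ultimately show ?thesis
    using S by (simp add: measure_def borel_compact)
qed

text \<open>Angles are arbitrary reals rather than principal arguments, so a sector may cross the
  branch cut of \<open>Arg\<close>. With \<open>a = b\<close> it degenerates to a circular
  arc.\<close>

definition annular_sector :: "complex \<Rightarrow> real \<Rightarrow> real \<Rightarrow> real \<Rightarrow> real \<Rightarrow> complex set"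
  where "annular_sector p a b \<alpha> \<beta> = (\<lambda>(\<rho>, \<theta>). p + rcis \<rho> \<theta>) ` ({a..b} \<times> {\<alpha>..\<beta>})"

lemma mem_annular_sector:
  "z \<in> annular_sector p a b \<alpha> \<beta> \<longleftrightarrow> (\<exists>\<rho> \<theta>. z = p + rcis \<rho> \<theta> \<and> a \<le> \<rho> \<and> \<rho> \<le> b \<and> \<alpha> \<le> \<theta> \<and> \<theta> \<le> \<beta>)"
  unfolding annular_sector_def by (auto; blast)

lemma compact_annular_sector: "compact (annular_sector p a b \<alpha> \<beta>)"
  unfolding annular_sector_def case_prod_beta rcis_def cis_conv_exp
  by (intro compact_continuous_image continuous_intros compact_Times compact_Icc)

lemma lmeasurable_annular_sector: "annular_sector p a b \<alpha> \<beta> \<in> lmeasurable"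
  by (rule lmeasurable_compact[OF compact_annular_sector])

lemma annular_sector_mono:
  "\<alpha>' \<le> \<alpha> \<Longrightarrow> \<beta> \<le> \<beta>' \<Longrightarrow> annular_sector p a b \<alpha> \<beta> \<subseteq> annular_sector p a b \<alpha>' \<beta>'"
  by (force simp: mem_annular_sector)

lemma annular_sector_eq_translation:
  "annular_sector p a b \<alpha> \<beta> = (+) p ` annular_sector 0 a b \<alpha> \<beta>"
  by (force simp: annular_sector_def)

lemma annular_sector_eq_rotation:
  "annular_sector 0 a b (\<alpha> + \<delta>) (\<beta> + \<delta>) = (*) (cis \<delta>) ` annular_sector 0 a b \<alpha> \<beta>"
proof (intro set_eqI iffI)
  have eq: "cis \<delta> * rcis \<rho> \<theta> = rcis \<rho> (\<theta> + \<delta>)" for \<rho> \<theta>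
    by (simp add: rcis_def cis_mult add.commute)
  fix z
  show "z \<in> annular_sector 0 a b (\<alpha> + \<delta>) (\<beta> + \<delta>)" if "z \<in> (*) (cis \<delta>) ` annular_sector 0 a b \<alpha> \<beta>"
    using that by (auto simp: mem_annular_sector eq) fastforce
  show "z \<in> (*) (cis \<delta>) ` annular_sector 0 a b \<alpha> \<beta>" if mem: "z \<in> annular_sector 0 a b (\<alpha> + \<delta>) (\<beta> + \<delta>)"
  proof -
    obtain \<rho> \<theta> where z: "z = rcis \<rho> \<theta>" "a \<le> \<rho>" "\<rho> \<le> b" "\<alpha> + \<delta> \<le> \<theta>" "\<theta> \<le> \<beta> + \<delta>"
      using mem unfolding mem_annular_sector add_0 by blast
    then show ?thesis
      by (intro image_eqI[of _ _ "rcis \<rho> (\<theta> - \<delta>)"]) (auto simp: mem_annular_sector eq intro!: exI)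
  qed
qed

text \<open>A translation and a rotation bring the sector to the origin and to initial angle 0, so
  its area depends on the angles only through the width.\<close>

lemma measure_annular_sector_shift:
  "measure lebesgue (annular_sector p a b \<alpha> \<beta>) = measure lebesgue (annular_sector 0 a b 0 (\<beta> - \<alpha>))"
  using annular_sector_eq_rotation[of a b 0 \<alpha> "\<beta> - \<alpha>"]
  by (simp add: annular_sector_eq_translation[of p] measure_translation measure_rotation
      compact_annular_sector)

lemma cis_eq_iff_int: "cis \<alpha> = cis \<beta> \<longleftrightarrow> (\<exists>n::int. \<alpha> = \<beta> + 2 * pi * n)"
  by (metis cis.sel cis.code complex.sel sin_cos_eq_iff)

lemma rcis_eq_iff_int:
  assumes "\<rho> > 0" "\<rho>' > 0"
  shows "rcis \<rho> \<alpha> = rcis \<rho>' \<beta> \<longleftrightarrow> \<rho> = \<rho>' \<and> (\<exists>n::int. \<alpha> = \<beta> + 2 * pi * n)"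
proof
  assume eq: "rcis \<rho> \<alpha> = rcis \<rho>' \<beta>"
  then have "norm (rcis \<rho> \<alpha>) = norm (rcis \<rho>' \<beta>)"
    by simp
  with assms have "\<rho> = \<rho>'"
    by simp
  with eq assms show "\<rho> = \<rho>' \<and> (\<exists>n::int. \<alpha> = \<beta> + 2 * pi * n)"
    by (simp add: rcis_def cis_eq_iff_int)
qed (use assms in \<open>auto simp: rcis_def cis_eq_iff_int\<close>)

text \<open>Since \<open>t\<close> runs over all reals, this is a whole line through 0, a subspace
  of dimension at most 1 in the plane.\<close>

lemma negligible_ray: "negligible (range (\<lambda>t. rcis t \<theta>))"
proof -
  have "range (\<lambda>t. rcis t \<theta>) = span {cis \<theta>}"
    by (auto simp: span_singleton rcis_def scaleR_conv_of_real)
  moreover have "dim {cis \<theta>} \<le> card {cis \<theta>}"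
    by (rule dim_le_card') simp
  ultimately show ?thesis
    by (intro negligible_lowdim) simp
qed

text \<open>The two pieces overlap only along the ray at angle \<open>\<beta>\<close> and, when they
  close up to a full turn, along the ray at angle \<open>\<alpha>\<close>. Both are
  negligible.\<close>

lemma measure_annular_sector_add:
  assumes a: "0 < a" and le: "\<alpha> \<le> \<beta>" "\<beta> \<le> \<delta>" "\<delta> \<le> \<alpha> + 2 * pi"
  shows "measure lebesgue (annular_sector 0 a b \<alpha> \<delta>)
       = measure lebesgue (annular_sector 0 a b \<alpha> \<beta>) + measure lebesgue (annular_sector 0 a b \<beta> \<delta>)"
proof -
  have un: "annular_sector 0 a b \<alpha> \<delta> = annular_sector 0 a b \<alpha> \<beta> \<union> annular_sector 0 a b \<beta> \<delta>"
  proof (intro equalityI Un_least annular_sector_mono subsetI)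
    fix z assume "z \<in> annular_sector 0 a b \<alpha> \<delta>"
    then obtain \<rho> \<theta> where "z = 0 + rcis \<rho> \<theta>" "a \<le> \<rho>" "\<rho> \<le> b" "\<alpha> \<le> \<theta>" "\<theta> \<le> \<delta>"
      unfolding mem_annular_sector by blast
    then show "z \<in> annular_sector 0 a b \<alpha> \<beta> \<union> annular_sector 0 a b \<beta> \<delta>"
      unfolding mem_annular_sector Un_iff by (cases "\<theta> \<le> \<beta>") force+
  qed (use le in auto)
  have "annular_sector 0 a b \<alpha> \<beta> \<inter> annular_sector 0 a b \<beta> \<delta>
      \<subseteq> range (\<lambda>t. rcis t \<alpha>) \<union> range (\<lambda>t. rcis t \<beta>)"
  proof
    fix z assume "z \<in> annular_sector 0 a b \<alpha> \<beta> \<inter> annular_sector 0 a b \<beta> \<delta>"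
    then obtain \<rho> \<theta> \<rho>' \<theta>' where z: "z = rcis \<rho> \<theta>" "z = rcis \<rho>' \<theta>'" "a \<le> \<rho>" "a \<le> \<rho>'"
      "\<alpha> \<le> \<theta>" "\<theta> \<le> \<beta>" "\<beta> \<le> \<theta>'" "\<theta>' \<le> \<delta>"
      unfolding mem_annular_sector Int_iff add_0 by blast
    then obtain n :: int where n: "\<theta>' = \<theta> + 2 * pi * n"
      using a rcis_eq_iff_int[of \<rho>' \<rho> \<theta>' \<theta>] by auto
    \<comment> \<open>The total width is at most one turn, so the two angles of \<open>z\<close>
      agree or differ by exactly one turn. The latter forces
      \<open>\<theta> = \<alpha>\<close>.\<close>
    have "2 * pi * n \<ge> 0" "2 * pi * n \<le> 2 * pi * 1"
      using n z le by linarith+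
    then have "0 \<le> n" "n \<le> 1"
      using pi_gt_zero by (auto simp: zero_le_mult_iff simp del: pi_gt_zero)
    then consider "n = 0" | "n = 1"
      by linarith
    then have "\<theta> = \<beta> \<or> \<theta> = \<alpha>"
      by cases (use n z le in auto)
    with z show "z \<in> range (\<lambda>t. rcis t \<alpha>) \<union> range (\<lambda>t. rcis t \<beta>)"
      by auto
  qed
  then have "negligible (annular_sector 0 a b \<alpha> \<beta> \<inter> annular_sector 0 a b \<beta> \<delta>)"
    by (rule negligible_subset[OF negligible_Un[OF negligible_ray negligible_ray]])
  then show ?thesis
    unfolding un by (subst measure_Un3) (auto simp: lmeasurable_annular_sector negligible_imp_measure0)
qed

lemma annular_sector_full:
  assumes a: "0 < a"
  shows "annular_sector 0 a b 0 (2 * pi) = cball 0 b - ball 0 a"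
proof (intro set_eqI iffI)
  fix z :: complex
  show "z \<in> cball 0 b - ball 0 a" if "z \<in> annular_sector 0 a b 0 (2 * pi)"
    using that a by (auto simp: mem_annular_sector)
  show "z \<in> annular_sector 0 a b 0 (2 * pi)" if "z \<in> cball 0 b - ball 0 a"
    using that Arg2pi[of z]
    by (simp add: mem_annular_sector) (rule exI[of _ "cmod z"], rule exI[of _ "Arg2pi z"],
      auto simp: is_Arg_def rcis_def cis_conv_exp)
qed

lemma measure_annular_sector_full:
  assumes "0 < a" "a \<le> b"
  shows "measure lebesgue (annular_sector 0 a b 0 (2 * pi)) = pi * (b\<^sup>2 - a\<^sup>2)"
proof -
  have "measure lebesgue (cball (0::complex) b - ball 0 a)
      = measure lebesgue (cball (0::complex) b) - measure lebesgue (ball (0::complex) a)"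
    using assms by (intro measurable_measure_Diff) (auto intro!: ball_subset_cball[THEN order_trans] subset_cball)
  also have "\<dots> = pi * (b\<^sup>2 - a\<^sup>2)"
    using assms by (simp add: content_cball content_ball unit_ball_vol_2 DIM_complex algebra_simps)
  finally show ?thesis
    using assms by (simp add: annular_sector_full)
qed

text \<open>Cauchy's functional equation on an interval: additivity settles the multiples of
  \<open>T / n\<close>, and nonnegativity makes \<open>F\<close> monotone, which controls the values
  in between.\<close>

lemma additive_nonneg_imp_linear:
  fixes F :: "real \<Rightarrow> real"
  assumes T: "T > 0"
    and add: "\<And>x y. 0 \<le> x \<Longrightarrow> 0 \<le> y \<Longrightarrow> x + y \<le> T \<Longrightarrow> F (x + y) = F x + F y"
    and nonneg: "\<And>x. 0 \<le> x \<Longrightarrow> x \<le> T \<Longrightarrow> 0 \<le> F x"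
    and w: "0 \<le> w" "w \<le> T"
  shows "F w = w / T * F T"
proof -
  have mono: "F x \<le> F y" if "0 \<le> x" "x \<le> y" "y \<le> T" for x y
    using add[of x "y - x"] nonneg[of "y - x"] that by simp
  have F0: "F 0 = 0"
    using add[of 0 0] T by simp
  have mult: "F (real k * x) = real k * F x" if "0 \<le> x" "real k * x \<le> T" for k x
    using that(2)
  proof (induction k)
    case (Suc k)
    have "real k * x \<le> T"
      using Suc.prems that(1) by (simp add: algebra_simps)
    then show ?case
      using Suc add[of "real k * x" x] that(1) by (simp add: algebra_simps)
  qed (simp add: F0)
  have bound: "\<bar>F w - w / T * F T\<bar> * real n \<le> F T" if n: "n > 0" for n
  proof (cases "w = T")
    case True
    then show ?thesis
      using T w nonneg[of T] by simp
  next
    case False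
    \<comment> \<open>\<open>w\<close> lies between the consecutive grid points
      \<open>k * T / n\<close> and \<open>(k + 1) * T / n\<close>. The case \<open>w = T\<close> is
      treated apart so that the upper one does not exceed \<open>T\<close>.\<close>
    define k where "k = nat \<lfloor>w / T * n\<rfloor>"
    have k: "real k \<le> w / T * n" "w / T * n < real (Suc k)"
      using T w unfolding k_def by (simp_all add: of_nat_nat) linarith
    have "w / T * n < n"
      using False T w n by (simp add: divide_less_eq mult.commute)
    with k have kn: "Suc k \<le> n"
      by linarith
    define x where "x = T / n"
    have x: "0 \<le> x" "real n * x = T"
      using T n by (auto simp: x_def)
    have Fx: "F T = real n * F x"
      using mult[of x n] x by simp
    have kx: "real k * x \<le> w" "w \<le> real (Suc k) * x"
      using k T n by (auto simp: x_def field_simps)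
    have Sk: "real (Suc k) * x \<le> T"
      using mult_right_mono[of "real (Suc k)" "real n" x] kn x by simp
    have "real k * F x \<le> F w"
      using mono[of "real k * x" w] mult[of x k] x kx w by simp
    moreover have "F w \<le> real (Suc k) * F x"
      using mono[of w "real (Suc k) * x"] mult[of x "Suc k"] x kx w Sk by simp
    moreover have "real k * F x \<le> w / T * F T" "w / T * F T \<le> real (Suc k) * F x"
    proof -
      have "0 \<le> F x"
        using x n mult_right_mono[of 1 "real n" x] by (intro nonneg) auto
      then show "real k * F x \<le> w / T * F T" "w / T * F T \<le> real (Suc k) * F x"
        using k unfolding Fx by (metis less_imp_le mult.assoc mult_right_mono)+
    qed
    ultimately have "\<bar>F w - w / T * F T\<bar> \<le> F x"
      by (simp add: algebra_simps abs_le_iff)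
    then show ?thesis
      using n unfolding Fx by (simp add: mult.commute)
  qed
  show ?thesis
  proof (rule ccontr)
    assume "F w \<noteq> w / T * F T"
    then obtain n where "F T < real n * \<bar>F w - w / T * F T\<bar>"
      using reals_Archimedean3[of "\<bar>F w - w / T * F T\<bar>"] by auto
    moreover from this have "n > 0"
      using nonneg[of T] T by (cases n) auto
    ultimately show False
      using bound[of n] by (simp add: mult.commute)
  qed
qed

text \<open>The area is additive and nonnegative as a function of the width, hence proportional to
  it; the full annulus gives the constant.\<close>

lemma measure_annular_sector:
  assumes ab: "0 < a" "a \<le> b" and w: "\<alpha> \<le> \<beta>" "\<beta> \<le> \<alpha> + 2 * pi"
  shows "measure lebesgue (annular_sector p a b \<alpha> \<beta>) = (\<beta> - \<alpha>) / 2 * (b\<^sup>2 - a\<^sup>2)"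
proof -
  define F where "F = (\<lambda>w. measure lebesgue (annular_sector 0 a b 0 w))"
  have "F (\<beta> - \<alpha>) = (\<beta> - \<alpha>) / (2 * pi) * F (2 * pi)"
  proof (rule additive_nonneg_imp_linear)
    show "F (x + y) = F x + F y" if "0 \<le> x" "0 \<le> y" "x + y \<le> 2 * pi" for x y
      using measure_annular_sector_add[of a 0 x "x + y" b] measure_annular_sector_shift[of 0 a b x "x + y"]
        ab that by (simp add: F_def)
  qed (use w in \<open>auto simp: F_def\<close>)
  then show ?thesis
    using ab by (simp add: measure_annular_sector_shift[of p] F_def measure_annular_sector_full)
qed

subsection \<open>Differentiating the area in a disk\<close>

lemma polar_coordinates_from:
  obtains \<theta> where "z = p + rcis (dist p z) \<theta>" "c \<le> \<theta>" "\<theta> < c + 2 * pi"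
proof -
  define t where "t = Arg (z - p)"
  \<comment> \<open>The least number of full turns that brings \<open>t\<close> to at least
    \<open>c\<close>.\<close>
  define n where "n = \<lceil>(c - t) / (2 * pi)\<rceil>"
  define \<theta> where "\<theta> = t + 2 * pi * n"
  have n: "(c - t) / (2 * pi) \<le> n" "n < (c - t) / (2 * pi) + 1"
    unfolding n_def by linarith+
  show thesis
  proof
    have "rcis (dist p z) \<theta> = rcis (dist p z) t"
      unfolding rcis_def using cis_eq_iff_int[of \<theta> t] by (auto simp: \<theta>_def)
    also have "\<dots> = z - p"
      using rcis_cmod_Arg[of "z - p"] by (simp add: t_def dist_norm norm_minus_commute)
    finally show "z = p + rcis (dist p z) \<theta>"
      by simp
    show "c \<le> \<theta>" "\<theta> < c + 2 * pi"
      using n by (auto simp: \<theta>_def field_simps)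
  qed
qed

text \<open>The arc is compact, so a uniform neighbourhood of it stays in \<open>U\<close>; changing
  the radius by less than \<open>\<delta>\<close> moves a point by less than
  \<open>\<delta>\<close>.\<close>

lemma annular_sector_subset_open:
  assumes U: "open U" and arc: "\<And>\<theta>. \<alpha> \<le> \<theta> \<Longrightarrow> \<theta> \<le> \<beta> \<Longrightarrow> p + rcis r \<theta> \<in> U"
  obtains \<delta> where "\<delta> > 0" "\<And>\<rho> \<theta>. \<bar>\<rho> - r\<bar> < \<delta> \<Longrightarrow> \<alpha> \<le> \<theta> \<Longrightarrow> \<theta> \<le> \<beta> \<Longrightarrow> p + rcis \<rho> \<theta> \<in> U"
proof -
  have "annular_sector p r r \<alpha> \<beta> \<subseteq> U"
    using arc by (auto simp: mem_annular_sector)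
  then obtain \<delta> where \<delta>: "\<delta> > 0" "(\<Union>z\<in>annular_sector p r r \<alpha> \<beta>. ball z \<delta>) \<subseteq> U"
    using compact_subset_open_imp_ball_epsilon_subset[OF compact_annular_sector U] by metis
  show thesis
  proof (rule that[OF \<delta>(1)])
    fix \<rho> \<theta> :: real assume h: "\<bar>\<rho> - r\<bar> < \<delta>" "\<alpha> \<le> \<theta>" "\<theta> \<le> \<beta>"
    have "rcis r \<theta> - rcis \<rho> \<theta> = rcis (r - \<rho>) \<theta>"
      by (simp add: rcis_def algebra_simps)
    then have "dist (p + rcis r \<theta>) (p + rcis \<rho> \<theta>) < \<delta>"
      using h(1) by (simp add: dist_norm)
    moreover have "p + rcis r \<theta> \<in> annular_sector p r r \<alpha> \<beta>"
      using h by (auto simp: mem_annular_sector)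
    ultimately show "p + rcis \<rho> \<theta> \<in> U"
      using \<delta>(2) by (meson UN_I mem_ball subsetD)
  qed
qed

text \<open>\<open>w / 2 * (b\<^sup>2 - a\<^sup>2)\<close> is the area of an annular sector of angle
  \<open>w\<close>. Divided by \<open>b - a\<close> it is \<open>w / 2 * (a + b)\<close>, which
  tends to \<open>w * r\<close>, and the relative error \<open>\<eta>\<close> is arbitrary.\<close>

lemma has_real_derivative_quadratic_squeeze:
  fixes G :: "real \<Rightarrow> real"
  assumes r: "r > 0"
    and squeeze: "\<And>\<eta>. \<eta> > 0 \<Longrightarrow> \<exists>\<delta>>0. \<forall>a b. r - \<delta> < a \<longrightarrow> a \<le> b \<longrightarrow> b < r + \<delta> \<longrightarrow>
      \<bar>(G b - G a) - w / 2 * (b\<^sup>2 - a\<^sup>2)\<bar> \<le> \<eta> * (b\<^sup>2 - a\<^sup>2)"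
  shows "(G has_real_derivative w * r) (at r)"
proof -
  have "((\<lambda>y. (G y - G r) / (y - r) - w / 2 * (y + r)) \<longlongrightarrow> 0) (at r)"
  proof (rule LIM_I)
    fix \<epsilon> :: real assume \<epsilon>: "\<epsilon> > 0"
    obtain \<delta> where \<delta>: "\<delta> > 0" and sq: "\<And>a b. r - \<delta> < a \<Longrightarrow> a \<le> b \<Longrightarrow> b < r + \<delta> \<Longrightarrow>
      \<bar>(G b - G a) - w / 2 * (b\<^sup>2 - a\<^sup>2)\<bar> \<le> \<epsilon> / (4 * r) * (b\<^sup>2 - a\<^sup>2)"
      using squeeze[of "\<epsilon> / (4 * r)"] \<epsilon> r by auto
    have "norm ((G y - G r) / (y - r) - w / 2 * (y + r) - 0) < \<epsilon>"
      if y: "y \<noteq> r" "norm (y - r) < min \<delta> r" for y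
    proof -
      \<comment> \<open>Ordering \<open>y\<close> and \<open>r\<close> treats both sides at once,
        since the difference quotient is symmetric.\<close>
      define a b where "a = min y r" and "b = max y r"
      have ab: "a < b" "r - \<delta> < a" "b < r + \<delta>" "b + a = y + r"
        using y \<delta> by (auto simp: a_def b_def min_def max_def split: if_splits)
      have "b\<^sup>2 - a\<^sup>2 = (b + a) * (b - a)"
        by (simp add: power2_eq_square algebra_simps)
      then have sqd: "b\<^sup>2 - a\<^sup>2 = (y + r) * (b - a)"
        by (simp only: ab(4))
      have q: "(G y - G r) / (y - r) = (G b - G a) / (b - a)"
      proof (cases "y \<le> r")
        case True
        then show ?thesis
          using minus_divide_divide[of "G r - G y" "r - y", unfolded minus_diff_eq]
          by (simp only: a_def b_def min_absorb1 max_absorb2)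
      qed (simp add: a_def b_def)
      have "(G y - G r) / (y - r) - w / 2 * (y + r)
          = ((G b - G a) - w / 2 * (b\<^sup>2 - a\<^sup>2)) / (b - a)"
        using ab(1) unfolding q sqd by (subst divide_diff_eq_iff) (auto simp only: mult.assoc right_minus_eq less_irrefl)
      then have "\<bar>(G y - G r) / (y - r) - w / 2 * (y + r)\<bar>
          = \<bar>(G b - G a) - w / 2 * (b\<^sup>2 - a\<^sup>2)\<bar> / (b - a)"
        using ab(1) by (simp only: abs_divide)
      also have "\<dots> \<le> \<epsilon> / (4 * r) * (b\<^sup>2 - a\<^sup>2) / (b - a)"
        using sq[of a b] ab by (intro divide_right_mono) auto
      also have "\<dots> = \<epsilon> / (4 * r) * (y + r)"
        using ab(1) unfolding sqd by simp
      \<comment> \<open>The bound \<open>norm (y - r) < r\<close> gives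
        \<open>y + r < 3 * r\<close>.\<close>
      also have "\<dots> < \<epsilon> / (4 * r) * (4 * r)"
        using y \<epsilon> r by (intro mult_strict_left_mono) auto
      finally show ?thesis
        using r by simp
    qed
    then show "\<exists>s>0. \<forall>y. y \<noteq> r \<and> norm (y - r) < s \<longrightarrow>
        norm ((G y - G r) / (y - r) - w / 2 * (y + r) - 0) < \<epsilon>"
      using \<delta> r by (intro exI[of _ "min \<delta> r"]) auto
  qed
  moreover have "((\<lambda>y. w / 2 * (y + r)) \<longlongrightarrow> w / 2 * (r + r)) (at r)"
    by (intro tendsto_intros)
  ultimately have "((\<lambda>y. (G y - G r) / (y - r) - w / 2 * (y + r) + w / 2 * (y + r)) \<longlongrightarrow> 0 + w / 2 * (r + r)) (at r)"
    by (rule tendsto_add)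
  then show ?thesis
    by (simp add: has_field_derivative_iff)
qed

lemma area_Int_cball_has_real_derivative:
  fixes \<Omega> :: "complex set"
  assumes \<Omega>: "compact \<Omega>" and r: "r > 0" and ang: "\<alpha> < \<beta>" "\<beta> < \<alpha> + 2 * pi"
    and ins: "\<And>\<theta>. \<alpha> < \<theta> \<Longrightarrow> \<theta> < \<beta> \<Longrightarrow> p + rcis r \<theta> \<in> interior \<Omega>"
    and outs: "\<And>\<theta>. \<beta> < \<theta> \<Longrightarrow> \<theta> < \<alpha> + 2 * pi \<Longrightarrow> p + rcis r \<theta> \<notin> \<Omega>"
  shows "((\<lambda>\<rho>. measure lebesgue (\<Omega> \<inter> cball p \<rho>)) has_real_derivative (\<beta> - \<alpha>) * r) (at r)"
proof (rule has_real_derivative_quadratic_squeeze[OF r])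
  define G where "G = (\<lambda>\<rho>. measure lebesgue (\<Omega> \<inter> cball p \<rho>))"
  fix \<eta>0 :: real assume "\<eta>0 > 0"
  \<comment> \<open>At most half of each arc, so that the inner arc cut back by
    \<open>\<eta>\<close> at both ends still exists and the one widened by \<open>\<eta>\<close> has
    width at most \<open>2 * pi\<close>.\<close>
  define \<eta> where "\<eta> = min \<eta>0 (min ((\<beta> - \<alpha>) / 2) ((2 * pi - (\<beta> - \<alpha>)) / 2))"
  have \<eta>: "\<eta> > 0" "\<eta> \<le> \<eta>0" "2 * \<eta> \<le> \<beta> - \<alpha>" "2 * \<eta> \<le> 2 * pi - (\<beta> - \<alpha>)"
    using ang \<open>\<eta>0 > 0\<close> by (auto simp: \<eta>_def min_def)
  have "p + rcis r \<theta> \<in> interior \<Omega>" if "\<alpha> + \<eta> \<le> \<theta>" "\<theta> \<le> \<beta> - \<eta>" for \<theta>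
    using that \<eta> by (intro ins) auto
  then obtain \<delta>1 where \<delta>1: "\<delta>1 > 0"
    "\<And>\<rho> \<theta>. \<bar>\<rho> - r\<bar> < \<delta>1 \<Longrightarrow> \<alpha> + \<eta> \<le> \<theta> \<Longrightarrow> \<theta> \<le> \<beta> - \<eta> \<Longrightarrow> p + rcis \<rho> \<theta> \<in> interior \<Omega>"
    using annular_sector_subset_open[OF open_interior, of "\<alpha> + \<eta>" "\<beta> - \<eta>" p r \<Omega>] by metis
  have "open (- \<Omega>)"
    using \<Omega> by (simp add: compact_imp_closed open_Compl)
  moreover have "p + rcis r \<theta> \<in> - \<Omega>" if "\<beta> + \<eta> \<le> \<theta>" "\<theta> \<le> \<alpha> + 2 * pi - \<eta>" for \<theta>
    using that \<eta> outs[of \<theta>] by auto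
  ultimately obtain \<delta>2 where \<delta>2: "\<delta>2 > 0"
    "\<And>\<rho> \<theta>. \<bar>\<rho> - r\<bar> < \<delta>2 \<Longrightarrow> \<beta> + \<eta> \<le> \<theta> \<Longrightarrow> \<theta> \<le> \<alpha> + 2 * pi - \<eta> \<Longrightarrow> p + rcis \<rho> \<theta> \<in> - \<Omega>"
    using annular_sector_subset_open[of "- \<Omega>" "\<beta> + \<eta>" "\<alpha> + 2 * pi - \<eta>" p r] by metis
  define \<delta> where "\<delta> = min r (min \<delta>1 \<delta>2)"
  have "\<bar>(G b - G a) - (\<beta> - \<alpha>) / 2 * (b\<^sup>2 - a\<^sup>2)\<bar> \<le> \<eta>0 * (b\<^sup>2 - a\<^sup>2)"
    if ab: "r - \<delta> < a" "a \<le> b" "b < r + \<delta>" for a b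
  proof -
    have a: "0 < a"
      using ab by (auto simp: \<delta>_def)
    have close: "\<bar>\<rho> - r\<bar> < \<delta>1" "\<bar>\<rho> - r\<bar> < \<delta>2" if "a \<le> \<rho>" "\<rho> \<le> b" for \<rho>
      using ab that by (auto simp: \<delta>_def)
    define D where "D = \<Omega> \<inter> cball p b - \<Omega> \<inter> cball p a"
    have meas: "\<Omega> \<inter> cball p b \<in> lmeasurable" "\<Omega> \<inter> cball p a \<in> lmeasurable"
      using \<Omega> by (auto intro!: lmeasurable_compact compact_Int_closed)
    then have D: "D \<in> lmeasurable"
      unfolding D_def by (rule fmeasurable.Diff)
    have GD: "G b - G a = measure lebesgue D"
      unfolding G_def D_def using meas ab by (subst measurable_measure_Diff) (auto intro: fmeasurableD)
    \<comment> \<open>Angles are taken in the turn starting at \<open>\<alpha> - \<eta>\<close>;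
      those beyond \<open>\<beta> + \<eta>\<close> belong to the outer arc, whose nearby points
      avoid \<open>\<Omega>\<close>.\<close>
    have "D \<subseteq> annular_sector p a b (\<alpha> - \<eta>) (\<beta> + \<eta>)"
    proof
      fix z assume z: "z \<in> D"
      obtain \<theta> where \<theta>: "z = p + rcis (dist p z) \<theta>" "\<alpha> - \<eta> \<le> \<theta>" "\<theta> < \<alpha> - \<eta> + 2 * pi"
        by (rule polar_coordinates_from)
      have d: "a \<le> dist p z" "dist p z \<le> b" "z \<in> \<Omega>"
        using z by (auto simp: D_def)
      have "\<theta> \<le> \<beta> + \<eta>"
        using \<delta>2(2)[of "dist p z" \<theta>] close(2)[OF d(1,2)] d(3) \<theta> by force
      with \<theta> d show "z \<in> annular_sector p a b (\<alpha> - \<eta>) (\<beta> + \<eta>)"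
        unfolding mem_annular_sector by blast
    qed
    then have "measure lebesgue D \<le> (\<beta> + \<eta> - (\<alpha> - \<eta>)) / 2 * (b\<^sup>2 - a\<^sup>2)"
      using a ab \<eta> D ang
      by (subst measure_annular_sector[of a b "\<alpha> - \<eta>" "\<beta> + \<eta>" p, symmetric])
         (auto intro: measure_mono_fmeasurable lmeasurable_annular_sector fmeasurableD)
    moreover have "(\<beta> - \<eta> - (\<alpha> + \<eta>)) / 2 * (b\<^sup>2 - a\<^sup>2) \<le> measure lebesgue D"
    proof -
      \<comment> \<open>\<open>D\<close> omits the inner circle, which the sector contains in part;
        this does not affect the area.\<close>
      have sph: "sphere p a \<in> null_sets lebesgue"
        using negligible_sphere negligible_iff_null_sets by blast
      have "annular_sector p a b (\<alpha> + \<eta>) (\<beta> - \<eta>) \<subseteq> D \<union> sphere p a"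
      proof
        fix z assume "z \<in> annular_sector p a b (\<alpha> + \<eta>) (\<beta> - \<eta>)"
        then obtain \<rho> \<theta> where z: "z = p + rcis \<rho> \<theta>" "a \<le> \<rho>" "\<rho> \<le> b" "\<alpha> + \<eta> \<le> \<theta>" "\<theta> \<le> \<beta> - \<eta>"
          unfolding mem_annular_sector by blast
        then have "z \<in> \<Omega>"
          using \<delta>1(2)[of \<rho> \<theta>] close(1)[of \<rho>] interior_subset by auto
        then show "z \<in> D \<union> sphere p a"
          using z a by (auto simp: D_def dist_norm)
      qed
      then have "measure lebesgue (annular_sector p a b (\<alpha> + \<eta>) (\<beta> - \<eta>)) \<le> measure lebesgue (D \<union> sphere p a)"
        using D by (intro measure_mono_fmeasurable fmeasurable.Un)
          (auto simp: fmeasurableD lmeasurable_annular_sector intro!: lmeasurable_compact)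
      also have "\<dots> = measure lebesgue D"
        using D sph by (intro measure_Un_null_set) auto
      finally show ?thesis
        using a ab \<eta> by (subst (asm) measure_annular_sector) auto
    qed
    moreover have "\<eta> * (b\<^sup>2 - a\<^sup>2) \<le> \<eta>0 * (b\<^sup>2 - a\<^sup>2)"
      using \<eta> a ab by (intro mult_right_mono) (auto intro: power_mono)
    ultimately show ?thesis
      unfolding GD by (simp add: abs_le_iff field_simps)
  qed
  moreover have "\<delta> > 0"
    using r \<delta>1 \<delta>2 by (simp add: \<delta>_def)
  ultimately show "\<exists>\<delta>>0. \<forall>a b. r - \<delta> < a \<longrightarrow> a \<le> b \<longrightarrow> b < r + \<delta> \<longrightarrow>
      \<bar>(measure lebesgue (\<Omega> \<inter> cball p b) - measure lebesgue (\<Omega> \<inter> cball p a))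
        - (\<beta> - \<alpha>) / 2 * (b\<^sup>2 - a\<^sup>2)\<bar> \<le> \<eta>0 * (b\<^sup>2 - a\<^sup>2)"
    unfolding G_def by (intro exI[of _ \<delta>] conjI allI impI)
qed

subsection \<open>Level sets and sides of a graph\<close>

text \<open>
  A minimum of \<open>\<rho>\<close> between two points of the superlevel set cannot lie at or below the level, so the
  superlevel set is an interval.
\<close>
lemma superlevel_set_interval:
  fixes \<rho> \<rho>' :: "real \<Rightarrow> real"
  assumes L: "L > 0" and cont: "continuous_on {0..L} \<rho>"
    and ends: "\<rho> 0 < c" "\<rho> L = \<rho> 0" "\<And>u. 0 < u \<Longrightarrow> u < L \<Longrightarrow> \<rho> 0 < \<rho> u"
    and deriv: "\<And>u. 0 < u \<Longrightarrow> u < L \<Longrightarrow> (\<rho> has_real_derivative \<rho>' u) (at u)"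
    and nocrit: "\<And>u. 0 < u \<Longrightarrow> u < L \<Longrightarrow> \<rho> u \<le> c \<Longrightarrow> \<rho>' u \<noteq> 0"
  obtains a b where "0 < a" "a < b" "b < L"
    "\<And>u. 0 \<le> u \<Longrightarrow> u \<le> L \<Longrightarrow> \<rho> u \<le> c \<longleftrightarrow> u \<le> a \<or> b \<le> u"
    "\<And>u. 0 \<le> u \<Longrightarrow> u \<le> L \<Longrightarrow> \<rho> u = c \<longleftrightarrow> u = a \<or> u = b"
proof -
  obtain m where m: "0 \<le> m" "m \<le> L" "\<And>u. 0 \<le> u \<Longrightarrow> u \<le> L \<Longrightarrow> \<rho> u \<le> \<rho> m"
    using continuous_attains_sup[of "{0..L}" \<rho>] cont L by auto
  have "\<rho> 0 < \<rho> m"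
    using m(3)[of "L / 2"] ends(3)[of "L / 2"] L by auto
  then have "m \<noteq> 0" "m \<noteq> L"
    using ends(2) by auto
  with m have m0: "0 < m" "m < L"
    by auto
  \<comment> \<open>The maximum is an interior critical point, so it must lie above the level. Hence
    \<open>a\<close> and \<open>b\<close> below, the first and last parameters with value at least
    \<open>c\<close>, exist.\<close>
  have "\<rho>' m = 0"
    using m0 m by (intro DERIV_local_max[OF deriv[OF m0], of "min m (L - m)"]) auto
  with nocrit[OF m0] have mc: "c < \<rho> m"
    by force
  define W where "W = {u \<in> {0..L}. c \<le> \<rho> u}"
  have "closed W"
    unfolding W_def by (intro continuous_closed_preimage_constant continuous_on_closed_Collect_le cont continuous_intros)
  then have W: "compact W" "W \<noteq> {}"
    using m mc by (auto simp: compact_eq_bounded_closed W_def intro: bounded_subset[OF bounded_closed_interval])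
  obtain a where a: "a \<in> W" "\<And>u. u \<in> W \<Longrightarrow> a \<le> u"
    using continuous_attains_inf[OF W continuous_on_id] by auto
  obtain b where b: "b \<in> W" "\<And>u. u \<in> W \<Longrightarrow> u \<le> b"
    using continuous_attains_sup[OF W continuous_on_id] by auto
  have ab: "0 < a" "b < L" "0 < b" "a < L"
    using a(1) b(1) ends L less_le by (force simp: W_def)+
  have "m \<in> W"
    using m mc by (simp add: W_def)
  have above: "c < \<rho> u" if uab: "a < u" "u < b" for u
  proof (rule ccontr)
    assume u: "\<not> c < \<rho> u"
    have "continuous_on {a..b} \<rho>"
      using cont ab by (elim continuous_on_subset) auto
    then obtain v where v: "a \<le> v" "v \<le> b" "\<And>w. a \<le> w \<Longrightarrow> w \<le> b \<Longrightarrow> \<rho> v \<le> \<rho> w"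
      using continuous_attains_inf[of "{a..b}" \<rho>] uab by auto
    \<comment> \<open>If the minimum is attained at an end point, its value is at least
      \<open>c\<close>, so the interior point \<open>u\<close> with \<open>\<rho> u \<le> c\<close>
      is a minimum too.\<close>
    have "\<exists>v. a < v \<and> v < b \<and> \<rho> v \<le> c \<and> (\<forall>w. a \<le> w \<longrightarrow> w \<le> b \<longrightarrow> \<rho> v \<le> \<rho> w)"
    proof (cases "v = a \<or> v = b")
      case True
      then have "c \<le> \<rho> v"
        using a(1) b(1) by (auto simp: W_def)
      with u uab v show ?thesis
        by (intro exI[of _ u]) (meson less_imp_le not_less order_trans)
    next
      case False
      with u uab v show ?thesis
        by (intro exI[of _ v]) (meson less_le not_less order_trans)
    qed
    then obtain v where v: "a < v" "v < b" "\<rho> v \<le> c" "\<And>w. a \<le> w \<Longrightarrow> w \<le> b \<Longrightarrow> \<rho> v \<le> \<rho> w"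
      by blast
    have "\<rho>' v = 0"
      by (rule DERIV_local_min[OF deriv, of v "min (v - a) (b - v)"]) (use v ab in auto)
    with nocrit[of v] v ab show False
      by auto
  qed
  have end_eq: "\<rho> a = c" "\<rho> b = c"
  proof -
    obtain x where x: "0 \<le> x" "x \<le> a" "\<rho> x = c"
      using IVT'[of \<rho> 0 c a] a(1) ends ab continuous_on_subset[OF cont, of "{0..a}"]
      by (auto simp: W_def)
    with a(2)[of x] a(1) show "\<rho> a = c"
      by (auto simp: W_def)
    obtain y where y: "b \<le> y" "y \<le> L" "\<rho> y = c"
      using IVT2'[of \<rho> L c b] b(1) ends ab continuous_on_subset[OF cont, of "{b..L}"]
      by (auto simp: W_def)
    with b(2)[of y] b(1) show "\<rho> b = c"
      by (auto simp: W_def)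
  qed
  have "a < b"
    using a(2)[OF \<open>m \<in> W\<close>] b(2)[OF \<open>m \<in> W\<close>] end_eq mc by (cases "a = b") auto
  have outside: "\<rho> u < c" if "0 \<le> u" "u \<le> L" "u < a \<or> b < u" for u
    using a(2)[of u] b(2)[of u] that by (force simp: W_def)
  show thesis
  proof (rule that[OF ab(1) \<open>a < b\<close> ab(2)])
    fix u assume u: "0 \<le> u" "u \<le> L"
    consider "u < a \<or> b < u" | "u = a \<or> u = b" | "a < u" "u < b"
      by linarith
    then show "\<rho> u \<le> c \<longleftrightarrow> u \<le> a \<or> b \<le> u" "\<rho> u = c \<longleftrightarrow> u = a \<or> u = b"
      using outside[OF u] above[of u] end_eq \<open>a < b\<close> by (cases; force)+
  qed
qed

text \<open>A connected set meeting both \<open>\<Omega>\<close> and its complement would meet the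
  frontier.\<close>

lemma connected_path_same_side:
  fixes c :: "real \<Rightarrow> complex"
  assumes "continuous_on I c" "connected I" "\<And>t. t \<in> I \<Longrightarrow> c t \<notin> frontier \<Omega>" "s \<in> I" "t \<in> I"
  shows "c s \<in> \<Omega> \<longleftrightarrow> c t \<in> \<Omega>"
  using connected_Int_frontier[OF connected_continuous_image[OF assms(1,2)], of \<Omega>] assms(3-) by blast

text \<open>Horizontal and vertical segments in the disk that miss the graph stay on one side of the
  boundary. Since the graph is flat at the origin, a small box has its top and bottom edges off the
  graph, and paths along these edges link nearby points to the axis.\<close>

lemma axis_points_sides:
  fixes \<Omega> :: "complex set"
  assumes \<Omega>: "closed \<Omega>" and r: "r > 0" and p: "p \<in> frontier \<Omega>"
    and f: "0 \<in> A" "f 0 = 0" "(f has_real_derivative 0) (at 0 within A)"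
    and graph: "frontier \<Omega> \<inter> cball p r = {p + e * Complex x (f x) | x. x \<in> A}"
    and e: "norm e = 1"
    and up: "\<forall>\<^sub>F \<epsilon> in at_right 0. p + e * Complex 0 \<epsilon> \<in> \<Omega>"
  shows "p + e * Complex 0 r \<in> \<Omega>" "p + e * Complex 0 (- r) \<notin> \<Omega>"
proof -
  define h where "h = (\<lambda>x y. p + e * Complex x y)"
  have e0: "e \<noteq> 0"
    using e by auto
  have dist_h: "dist p (h x y) = cmod (Complex x y)" for x y
    by (simp add: h_def dist_norm norm_mult e)
  have off: "h x y \<notin> frontier \<Omega>" if "cmod (Complex x y) \<le> r" "x \<in> A \<Longrightarrow> y \<noteq> f x" for x y
  proof
    assume "h x y \<in> frontier \<Omega>"
    then have "h x y \<in> {p + e * Complex x (f x) | x. x \<in> A}"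
      using that dist_h[of x y] unfolding graph[symmetric] by simp
    with that e0 show False
      by (auto simp: h_def)
  qed
  have vert: "h x s \<in> \<Omega> \<longleftrightarrow> h x t \<in> \<Omega>"
    if "\<And>y. min s t \<le> y \<Longrightarrow> y \<le> max s t \<Longrightarrow> cmod (Complex x y) \<le> r \<and> (x \<in> A \<longrightarrow> y \<noteq> f x)" for x s t
    by (rule connected_path_same_side[of "{min s t..max s t}" "h x"])
       (use that off in \<open>auto simp: h_def Complex_eq intro!: continuous_intros\<close>)
  have horiz: "h s y \<in> \<Omega> \<longleftrightarrow> h t y \<in> \<Omega>"
    if "\<And>x. min s t \<le> x \<Longrightarrow> x \<le> max s t \<Longrightarrow> cmod (Complex x y) \<le> r \<and> (x \<in> A \<longrightarrow> y \<noteq> f x)" for y s t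
    by (rule connected_path_same_side[of "{min s t..max s t}" "\<lambda>x. h x y"])
       (use that off in \<open>auto simp: h_def Complex_eq intro!: continuous_intros\<close>)
  \<comment> \<open>As \<open>f 0 = 0\<close>, the vertical axis meets the graph only at the origin,
    so each half of it within the disk lies on one side.\<close>
  have axis: "h 0 s \<in> \<Omega> \<longleftrightarrow> h 0 t \<in> \<Omega>" if "s * t > 0" "\<bar>s\<bar> \<le> r" "\<bar>t\<bar> \<le> r" for s t
    by (rule vert) (use that f in \<open>auto simp: cmod_def min_def max_def zero_less_mult_iff split: if_splits\<close>)
  obtain d where d: "d > 0" "\<And>x. x \<in> A \<Longrightarrow> \<bar>x\<bar> < d \<Longrightarrow> \<bar>f x\<bar> \<le> \<bar>x\<bar> / 2"
  proof -
    have "\<exists>d>0. \<forall>x\<in>A. norm (x - 0) < d \<longrightarrow> norm (f x - f 0 - 0 * (x - 0)) \<le> 1 / 2 * norm (x - 0)"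
      using f(3) unfolding has_field_derivative_def has_derivative_within_alt
      by (elim conjE allE[of _ "1 / 2"]) simp
    then show thesis
      using that f(2) by auto
  qed
  \<comment> \<open>\<open>r / 4\<close> keeps the box of half-width \<open>\<delta>\<close> inside
    the disk; \<open>d / 2\<close> makes the slope bound valid on it, so the graph stays strictly
    between its top and bottom edges.\<close>
  define \<delta> where "\<delta> = min (d / 2) (r / 4)"
  have \<delta>: "\<delta> > 0" "\<delta> < d" "2 * \<delta> \<le> r"
    using d r by (auto simp: \<delta>_def)
  have small: "cmod (Complex x y) \<le> r" if "\<bar>x\<bar> \<le> \<delta>" "\<bar>y\<bar> \<le> \<delta>" for x y
    using cmod_le[of "Complex x y"] that \<delta> by simp
  have f\<delta>: "\<bar>f x\<bar> < \<delta>" if "x \<in> A" "\<bar>x\<bar> \<le> \<delta>" for x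
    using d(2)[of x] that \<delta> by linarith
  have "\<forall>\<^sub>F \<epsilon> in at_right 0. \<epsilon> \<in> {0<..<\<delta>}"
    using \<delta>(1) by (intro eventually_at_right_real)
  with up have "\<exists>\<epsilon>. p + e * Complex 0 \<epsilon> \<in> \<Omega> \<and> \<epsilon> \<in> {0<..<\<delta>}"
    by (intro eventually_happens'[OF _ eventually_conj]) auto
  then obtain \<epsilon> where \<epsilon>: "0 < \<epsilon>" "\<epsilon> < \<delta>" "h 0 \<epsilon> \<in> \<Omega>"
    by (auto simp: h_def)
  have up\<delta>: "h 0 \<delta> \<in> \<Omega>"
    using axis[of \<epsilon> \<delta>] \<epsilon> \<delta> by simp
  then show "p + e * Complex 0 r \<in> \<Omega>"
    using axis[of \<delta> r] \<delta> r by (simp add: h_def)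
  \<comment> \<open>Points outside \<open>\<Omega>\<close> occur arbitrarily close to the frontier
    point \<open>p\<close>; one of them is now located relative to the graph.\<close>
  obtain z where z: "z \<notin> \<Omega>" "dist p z < \<delta>"
    using p \<delta>(1) unfolding frontier_straddle by (auto simp: dist_commute)
  define x y where "x = Re ((z - p) / e)" and "y = Im ((z - p) / e)"
  have zh: "z = h x y"
    using e0 by (simp add: h_def x_def y_def)
  have xy: "\<bar>x\<bar> \<le> \<delta>" "\<bar>y\<bar> \<le> \<delta>"
    using z(2) abs_Re_le_cmod[of "Complex x y"] abs_Im_le_cmod[of "Complex x y"] by (auto simp: zh dist_h)
  have level: "h x t \<in> \<Omega> \<longleftrightarrow> h 0 t \<in> \<Omega>" if "\<bar>t\<bar> = \<delta>" for t
    by (rule horiz) (use that xy in \<open>auto simp: min_def max_def split: if_splits intro!: small dest!: f\<delta>\<close>)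
  have "z \<notin> frontier \<Omega>"
    using z \<Omega> by (auto simp: frontier_def)
  moreover have "dist p z \<le> r"
    using z \<delta> by simp
  ultimately have ne: "y \<noteq> f x" if "x \<in> A"
    using graph that by (force simp: zh h_def)
  \<comment> \<open>Otherwise \<open>z\<close> could go straight up to the top edge of the box and
    along it to the axis, ending at \<open>h 0 \<delta>\<close> in \<open>\<Omega>\<close>.\<close>
  have "x \<in> A \<and> y < f x"
  proof (rule ccontr)
    assume nb: "\<not> (x \<in> A \<and> y < f x)"
    have "h x y \<in> \<Omega> \<longleftrightarrow> h x \<delta> \<in> \<Omega>"
      by (rule vert) (use nb ne xy in \<open>auto simp: min_def max_def split: if_splits intro!: small\<close>)
    with level[of \<delta>] up\<delta> z \<delta> show False
      by (simp add: zh)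
  qed
  \<comment> \<open>From below the graph, \<open>z\<close> goes down to the bottom edge, along it to
    the axis, and down to the circle.\<close>
  then have "h x y \<in> \<Omega> \<longleftrightarrow> h x (- \<delta>) \<in> \<Omega>"
    by (intro vert) (use xy in \<open>auto simp: min_def max_def split: if_splits intro!: small\<close>)
  with level[of "- \<delta>"] z \<delta> axis[of "- \<delta>" "- r"] r show "p + e * Complex 0 (- r) \<notin> \<Omega>"
    by (simp add: zh h_def)
qed

subsection \<open>The boundary curve\<close>

lemma periodic_ext_add_period:
  assumes "L > 0"
  shows "periodic_ext L \<gamma> (t + of_int n * L) = periodic_ext L \<gamma> t"
proof -
  have "(t + of_int n * L) / L = t / L + of_int n"
    using assms by (simp add: add_divide_distrib)
  then show ?thesis
    by (simp add: periodic_ext_def frac_def)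
qed

lemma periodic_ext_eq:
  assumes "L > 0" "0 \<le> t" "t < L"
  shows "periodic_ext L \<gamma> t = \<gamma> t"
  using assms by (simp add: periodic_ext_def frac_eq_id)

lemma frac_scaled:
  fixes L t :: real
  assumes "L > 0"
  shows "0 \<le> L * frac (t / L)" "L * frac (t / L) < L" "t = L * frac (t / L) + of_int \<lfloor>t / L\<rfloor> * L"
proof -
  show "0 \<le> L * frac (t / L)" "L * frac (t / L) < L"
    using assms frac_lt_1[of "t / L"] by simp_all
  have "t = L * (t / L)"
    using assms by simp
  also have "t / L = frac (t / L) + of_int \<lfloor>t / L\<rfloor>"
    by (simp add: frac_def)
  finally show "t = L * frac (t / L) + of_int \<lfloor>t / L\<rfloor> * L"
    by (simp only: distrib_left mult.commute)
qed

lemma periodic_ext_eqD: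
  assumes "L > 0" "inj_on \<gamma> {0..<L}" "periodic_ext L \<gamma> t = periodic_ext L \<gamma> t'"
  shows "\<exists>n::int. t = t' + of_int n * L"
proof -
  have "L * frac (t / L) = L * frac (t' / L)"
    using frac_scaled(1,2)[OF assms(1)] assms(3)
    by (intro inj_onD[OF assms(2)]) (auto simp: periodic_ext_def)
  then have "t = t' + of_int (\<lfloor>t / L\<rfloor> - \<lfloor>t' / L\<rfloor>) * L"
    using frac_scaled(3)[OF assms(1), of t] frac_scaled(3)[OF assms(1), of t']
    unfolding of_int_diff left_diff_distrib by linarith
  then show ?thesis
    by blast
qed

lemma periodic_ext_inj:
  assumes "L > 0" "inj_on \<gamma> {0..<L}" "periodic_ext L \<gamma> t = periodic_ext L \<gamma> t'" "\<bar>t - t'\<bar> < L"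
  shows "t = t'"
proof -
  obtain n :: int where n: "t = t' + of_int n * L"
    using periodic_ext_eqD[OF assms(1-3)] by blast
  with assms(1,4) have "\<bar>of_int n :: real\<bar> < 1"
    by (simp add: abs_mult)
  then have "n = 0"
    by linarith
  with n show ?thesis
    by simp
qed

lemma range_periodic_ext_window:
  assumes "L > 0"
  shows "periodic_ext L \<gamma> ` {s..<s + L} = \<gamma> ` {0..<L}"
proof (intro equalityI subsetI)
  fix z assume "z \<in> periodic_ext L \<gamma> ` {s..<s + L}"
  then show "z \<in> \<gamma> ` {0..<L}"
    using frac_scaled(1,2)[OF assms] by (auto simp: periodic_ext_def)
next
  fix z assume "z \<in> \<gamma> ` {0..<L}"
  then obtain t where t: "z = \<gamma> t" "0 \<le> t" "t < L"
    by auto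
  have "z = periodic_ext L \<gamma> (s + L * frac ((t - s) / L))"
    using t frac_scaled(3)[OF assms, of "t - s"] periodic_ext_eq[OF assms t(2,3), of \<gamma>]
      periodic_ext_add_period[OF assms, of \<gamma> "s + L * frac ((t - s) / L)" "\<lfloor>(t - s) / L\<rfloor>"]
    by (simp add: algebra_simps)
  then show "z \<in> periodic_ext L \<gamma> ` {s..<s + L}"
    using frac_scaled(1,2)[OF assms] by auto
qed

lemma has_vector_derivative_velocity:
  assumes "C1_boundary_param L \<gamma>"
  shows "(periodic_ext L \<gamma> has_vector_derivative velocity L \<gamma> t) (at t)"
    and "continuous_on UNIV (velocity L \<gamma>)"
  using assms by (auto simp: C1_boundary_param_def C1_differentiable_on_eq vector_derivative_works)

text \<open>For a \<open>C\<^sup>1\<close> curve the left limit of the derivative is the velocity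
  itself; the cone coefficients are 1 and 0.\<close>

lemma velocity_in_tangent_cone:
  assumes "C1_boundary_param L \<gamma>"
  shows "velocity L \<gamma> t \<in> tangent_cone L \<gamma> t"
proof -
  have "isCont (velocity L \<gamma>) t"
    using has_vector_derivative_velocity(2)[OF assms] by (simp add: continuous_on_eq_continuous_at)
  then have "(velocity L \<gamma> \<longlongrightarrow> velocity L \<gamma> t) (at_left t)"
    unfolding isCont_def by (rule tendsto_within_subset) simp
  then have "Lim (at_left t) (velocity L \<gamma>) = velocity L \<gamma> t"
    by (intro tendsto_Lim trivial_limit_at_left_real)
  then show ?thesis
    unfolding tangent_cone_def mem_Collect_eq by (intro exI[of _ 1] exI[of _ 0]) simp
qed

lemma velocity_add_period:
  assumes L: "L > 0" and C1: "C1_boundary_param L \<gamma>"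
  shows "velocity L \<gamma> (t + of_int n * L) = velocity L \<gamma> t"
proof -
  have "((\<lambda>x. periodic_ext L \<gamma> (x + of_int n * L)) has_vector_derivative
      1 *\<^sub>R velocity L \<gamma> (t + of_int n * L)) (at t)"
    using has_vector_derivative_velocity(1)[OF C1]
    by (intro vector_diff_chain_at[unfolded o_def, of "\<lambda>x. x + of_int n * L" 1]) (auto intro!: derivative_eq_intros)
  then show ?thesis
    using vector_derivative_at[of "periodic_ext L \<gamma>"] by (simp add: periodic_ext_add_period[OF L])
qed

text \<open>The tangent-cone condition concerns parameters in \<open>{0..<L}\<close>; periodicity of
  the curve and its velocity extends it to all \<open>t\<close>.\<close>

lemma velocity_inner_chord_nonzero:
  assumes L: "L > 0" and C1: "C1_boundary_param L \<gamma>" and tc: "tangent_cone_graph_like \<Omega> L \<gamma> r"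
    and uv: "u \<in> frontier \<Omega>" "v \<in> frontier \<Omega>" "u \<noteq> v"
      "dist (periodic_ext L \<gamma> t) u \<le> r" "dist (periodic_ext L \<gamma> t) v \<le> r"
  shows "velocity L \<gamma> t \<bullet> (u - v) \<noteq> 0"
proof -
  define t' where "t' = L * frac (t / L)"
  have t': "0 \<le> t'" "t' < L" "t = t' + of_int \<lfloor>t / L\<rfloor> * L"
    unfolding t'_def using frac_scaled[OF L] by blast+
  have "velocity L \<gamma> t = velocity L \<gamma> t'"
    using velocity_add_period[OF L C1, of t'] t'(3) by metis
  moreover have "periodic_ext L \<gamma> t = \<gamma> t'"
    by (simp add: periodic_ext_def t'_def)
  ultimately show ?thesis
    using tc t'(1,2) uv velocity_in_tangent_cone[OF C1, of t']
    unfolding tangent_cone_graph_like_def by (metis Int_iff atLeastLessThan_iff mem_cball)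
qed

text \<open>
  For \<open>q \<noteq> p\<close> on the boundary with \<open>dist p q \<le> r\<close>, both points lie in the disk about \<open>q\<close>, so the
  hypothesis at \<open>q\<close> says that the distance to \<open>p\<close> is not stationary at \<open>q\<close>.
\<close>
lemma boundary_crosses_sphere_twice:
  assumes par: "arclength_boundary_param \<Omega> L \<gamma>" and r: "r > 0"
    and tc: "tangent_cone_graph_like \<Omega> L \<gamma> r" and C1: "C1_boundary_param L \<gamma>" and s: "s \<in> {0..<L}"
    and graph: "frontier \<Omega> \<inter> cball (\<gamma> s) r = {\<gamma> s + e * Complex x (f x) | x. x \<in> A}" and e: "e \<noteq> 0"
  obtains q1 q2 where "frontier \<Omega> \<inter> sphere (\<gamma> s) r = {q1, q2}"
    "Re ((q1 - \<gamma> s) / e) > 0" "Re ((q2 - \<gamma> s) / e) < 0"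
proof -
  \<comment> \<open>The boundary is traversed once from \<open>\<gamma> s\<close> back to itself, so
    that \<open>\<gamma> s\<close> sits at both ends of \<open>{0..L}\<close>.\<close>
  define P where "P = (\<lambda>u. periodic_ext L \<gamma> (s + u))"
  define D where "D = (\<lambda>u. velocity L \<gamma> (s + u))"
  define p where "p = \<gamma> s"
  \<comment> \<open>The squared distance is differentiable at \<open>p\<close> as well.\<close>
  define \<rho> where "\<rho> = (\<lambda>u. (P u - p) \<bullet> (P u - p))"
  have L: "L > 0" and inj: "inj_on \<gamma> {0..<L}" and fr: "frontier \<Omega> = \<gamma> ` {0..L}" and cl: "\<gamma> 0 = \<gamma> L"
    using par by (auto simp: arclength_boundary_param_def)
  have P0: "P 0 = p"
    using s L by (simp add: P_def p_def periodic_ext_eq)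
  have Pper: "P (u - L) = P u" "P (u + L) = P u" for u
    using periodic_ext_add_period[OF L, of \<gamma> "s + u" "-1"] periodic_ext_add_period[OF L, of \<gamma> "s + u" 1]
    by (simp_all add: P_def algebra_simps)
  have Pinj: "u = v" if "P u = P v" "\<bar>u - v\<bar> < L" for u v
    using periodic_ext_inj[OF L inj, of "s + u" "s + v"] that by (simp add: P_def)
  have frP: "frontier \<Omega> = P ` {0..<L}"
  proof -
    have "\<gamma> ` {0..L} = \<gamma> ` {0..<L}"
    proof (intro equalityI subsetI)
      fix z assume "z \<in> \<gamma> ` {0..L}"
      then obtain t where "z = \<gamma> t" "0 \<le> t" "t \<le> L"
        by auto
      then show "z \<in> \<gamma> ` {0..<L}"
        using L cl by (intro image_eqI[of _ _ "if t = L then 0 else t"]) auto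
    qed auto
    also have "\<dots> = periodic_ext L \<gamma> ` (+) s ` {0..<L}"
      using range_periodic_ext_window[OF L, of \<gamma> s] by (simp add: add.commute)
    also have "\<dots> = P ` {0..<L}"
      by (simp only: P_def image_image)
    finally show ?thesis
      by (simp only: fr)
  qed
  have Pfr: "P u \<in> frontier \<Omega>" for u
    using frac_scaled(1,2)[OF L, of "s + u"] fr by (auto simp: P_def periodic_ext_def less_imp_le)
  have Pder: "(P has_vector_derivative D u) (at u)" for u
  proof -
    have "((\<lambda>u. s + u) has_vector_derivative 1) (at u)"
      by (auto intro!: derivative_eq_intros)
    from vector_diff_chain_at[OF this has_vector_derivative_velocity(1)[OF C1]] show ?thesis
      by (simp add: P_def D_def o_def)
  qed
  have Pcont: "continuous_on S P" for S
    using Pder by (meson continuous_at_imp_continuous_on has_vector_derivative_continuous)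
  have \<rho>_le: "\<rho> u \<le> r\<^sup>2 \<longleftrightarrow> dist p (P u) \<le> r" "\<rho> u = r\<^sup>2 \<longleftrightarrow> dist p (P u) = r" for u
    using r by (auto simp: \<rho>_def dot_square_norm dist_norm norm_minus_commute abs_le_square_iff[symmetric]
      power2_eq_iff_nonneg)
  have \<rho>_der: "(\<rho> has_real_derivative 2 * (D u \<bullet> (P u - p))) (at u)" for u
    using Pder[of u] unfolding \<rho>_def has_vector_derivative_def has_field_derivative_def
    by (auto intro!: derivative_eq_intros simp: inner_commute algebra_simps fun_eq_iff)
  have nocrit: "2 * (D u \<bullet> (P u - p)) \<noteq> 0" if "0 < u" "u < L" "\<rho> u \<le> r\<^sup>2" for u
  proof -
    have "P u \<noteq> p"
      using Pinj[of u 0] that P0 by auto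
    moreover have "periodic_ext L \<gamma> (s + u) = P u"
      by (simp add: P_def)
    ultimately show ?thesis
      using velocity_inner_chord_nonzero[OF L C1 tc Pfr[of u] Pfr[of 0], of "s + u"] that r
      by (simp add: D_def P0 \<rho>_le dist_commute)
  qed
  obtain a b where ab: "0 < a" "a < b" "b < L"
    and le: "\<And>u. 0 \<le> u \<Longrightarrow> u \<le> L \<Longrightarrow> \<rho> u \<le> r\<^sup>2 \<longleftrightarrow> u \<le> a \<or> b \<le> u"
    and eq: "\<And>u. 0 \<le> u \<Longrightarrow> u \<le> L \<Longrightarrow> \<rho> u = r\<^sup>2 \<longleftrightarrow> u = a \<or> u = b"
  proof (rule superlevel_set_interval[of L \<rho> "r\<^sup>2" "\<lambda>u. 2 * (D u \<bullet> (P u - p))"])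
    show "continuous_on {0..L} \<rho>"
      unfolding \<rho>_def by (intro continuous_intros Pcont)
    show "\<rho> 0 < \<rho> u" if "0 < u" "u < L" for u
      using Pinj[of u 0] that P0 by (auto simp: \<rho>_def)
    show "\<rho> L = \<rho> 0"
      using Pper(2)[of 0] by (simp add: \<rho>_def)
  qed (use L r P0 \<rho>_der nocrit in \<open>auto simp: \<rho>_def\<close>)
  have sph: "frontier \<Omega> \<inter> sphere p r = {P a, P b}"
  proof -
    have "P u \<in> sphere p r \<longleftrightarrow> u = a \<or> u = b" if "u \<in> {0..<L}" for u
      using eq[of u] that by (simp add: \<rho>_le)
    then show ?thesis
      using ab unfolding frP by force
  qed
  define x where "x = (\<lambda>u. Re ((P u - p) / e))"
  \<comment> \<open>Moving the returning piece \<open>{b..L}\<close> back by one period joins it to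
    \<open>{0..a}\<close>, giving a single arc through \<open>p\<close> at parameter 0.\<close>
  have inK: "P u \<in> frontier \<Omega> \<inter> cball p r" if "u \<in> {b - L..a}" for u
  proof (cases "0 \<le> u")
    case True
    then show ?thesis
      using that ab le[of u] Pfr by (simp add: \<rho>_le)
  next
    case False
    then show ?thesis
      using that ab le[of "u + L"] Pfr Pper(2)[of u] by (simp add: \<rho>_le)
  qed
  have "inj_on x {b - L..a}"
  proof (rule inj_onI)
    fix u v assume u: "u \<in> {b - L..a}" and v: "v \<in> {b - L..a}" and uv: "x u = x v"
    have "P w = p + e * Complex (x w) (f (x w))" if "w \<in> {b - L..a}" for w
      using inK[OF that] graph e by (auto simp: p_def x_def)
    then have "P u = P v"
      using u v uv by metis
    then show "u = v"
      using Pinj[of u v] u v ab by auto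
  qed
  moreover have "continuous_on {b - L..a} x"
    unfolding x_def using e by (intro continuous_intros Pcont) auto
  \<comment> \<open>A continuous injective function on an interval is strictly monotone, so the two
    ends of the arc lie on opposite sides of \<open>p\<close>.\<close>
  ultimately have "(x (b - L) < x 0 \<and> x 0 < x a) \<or> (x a < x 0 \<and> x 0 < x (b - L))"
    using ab by (intro continuous_inj_imp_mono) auto
  moreover have "x 0 = 0" "x (b - L) = x b"
    by (simp_all add: x_def P0 Pper)
  ultimately consider "x a > 0" "x b < 0" | "x b > 0" "x a < 0"
    by auto
  then show thesis
    using that[of "P a" "P b"] that[of "P b" "P a"] sph
    by cases (auto simp: x_def p_def insert_commute)
qed

subsection \<open>Circular arcs\<close>

lemma rcis_neq_between:
  assumes "r > 0" "\<beta> < \<theta>" "\<theta> < \<beta> + 2 * pi"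
  shows "rcis r \<theta> \<noteq> rcis r \<beta>"
proof
  assume "rcis r \<theta> = rcis r \<beta>"
  then obtain n :: int where n: "\<theta> = \<beta> + 2 * pi * n"
    using assms rcis_eq_iff_int[of r r \<theta> \<beta>] by auto
  then have "0 < 2 * pi * n" "2 * pi * n < 2 * pi * 1"
    using assms by linarith+
  then have "0 < n" "n < 1"
    using pi_gt_zero by (auto simp: zero_less_mult_iff simp del: pi_gt_zero)
  then show False
    by simp
qed

text \<open>The standard parameterization has constant speed
  \<open>(\<beta> - \<alpha>) * r\<close>, and a width below a full turn makes it injective.\<close>

lemma has_curve_length_circular_arc:
  assumes r: "r > 0" and ang: "\<alpha> < \<beta>" "\<beta> < \<alpha> + 2 * pi"
  shows "has_curve_length {p + rcis r \<theta> | \<theta>. \<alpha> \<le> \<theta> \<and> \<theta> \<le> \<beta>} ((\<beta> - \<alpha>) * r)"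
proof -
  have "path_image (part_circlepath p r \<alpha> \<beta>) = {p + rcis r \<theta> | \<theta>. \<alpha> \<le> \<theta> \<and> \<theta> \<le> \<beta>}"
    using ang by (simp add: path_image_part_circlepath rcis_def cis_conv_exp)
  moreover have "norm (vector_derivative (part_circlepath p r \<alpha> \<beta>) (at t)) = (\<beta> - \<alpha>) * r" for t
    using r ang by (simp add: vector_derivative_part_circlepath norm_mult flip: of_real_diff)
  moreover have "((\<lambda>t::real. (\<beta> - \<alpha>) * r) has_integral (\<beta> - \<alpha>) * r) {0..1}"
    using has_integral_const_real[of "(\<beta> - \<alpha>) * r" 0 1] by simp
  ultimately show ?thesis
    using r ang unfolding has_curve_length_def
    by (intro exI[of _ "part_circlepath p r \<alpha> \<beta>"]) (auto intro!: arc_part_circlepath)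
qed

lemma Arg_polar:
  assumes "Re z > 0" "norm z = r"
  shows "z = rcis r (Arg z)" "- pi / 2 < Arg z" "Arg z < pi / 2"
  using assms rcis_cmod_Arg[of z] Arg_Re_pos[of z] by auto

section \<open>The arc of the circle inside \<open>\<Omega>\<close> and the derivative of the
  area\<close>

theorem lemma4p4p1:
  fixes \<Omega> :: "complex set" and \<gamma> :: "real \<Rightarrow> complex" and L r s :: real and e :: complex
  assumes "compact \<Omega>"
    and "arclength_boundary_param \<Omega> L \<gamma>"
    and "r > 0"
    and "tangent_cone_graph_like \<Omega> L \<gamma> r"
    and "s \<in> {0..<L}"
    and "tangentially_graph_like \<Omega> L \<gamma> (\<gamma> s) r"
    and "graph_coords \<Omega> (\<gamma> s) r e"
  shows "\<exists>\<theta>1 \<theta>2.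
    \<theta>1 \<in> {- pi / 2<..<pi / 2} \<and> \<theta>2 \<in> {pi / 2<..<3 * pi / 2} \<and>
    frontier \<Omega> \<inter> sphere (\<gamma> s) r = {\<gamma> s + e * rcis r \<theta>1, \<gamma> s + e * rcis r \<theta>2} \<and>
    ((\<lambda>\<rho>. disk_area \<Omega> \<gamma> s \<rho>) has_real_derivative (\<theta>2 - \<theta>1) * r) (at r) \<and>
    has_curve_length (sphere (\<gamma> s) r \<inter> \<Omega>) ((\<theta>2 - \<theta>1) * r)"
proof -
  define p where "p = \<gamma> s"
  obtain A f where e: "norm e = 1"
    and f: "0 \<in> A" "f 0 = 0" "(f has_real_derivative 0) (at 0 within A)"
    and graph: "frontier \<Omega> \<inter> cball p r = {p + e * Complex x (f x) | x. x \<in> A}"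
    and up: "\<forall>\<^sub>F \<epsilon> in at_right 0. p + e * Complex 0 \<epsilon> \<in> \<Omega>"
    using assms(7) unfolding graph_coords_def p_def by blast
  have e0: "e \<noteq> 0"
    using e by auto
  have C1: "C1_boundary_param L \<gamma>"
    using assms(6) by (simp add: tangentially_graph_like_def)
  have closed: "closed \<Omega>"
    using assms(1) by (rule compact_imp_closed)
  have p: "p \<in> frontier \<Omega>"
    using assms(2,5) by (auto simp: arclength_boundary_param_def p_def)
  note sides = axis_points_sides[OF closed assms(3) p f graph e up]
  obtain q1 q2 where q: "frontier \<Omega> \<inter> sphere p r = {q1, q2}"
    and q1: "Re ((q1 - p) / e) > 0" and q2: "Re ((q2 - p) / e) < 0"
    using boundary_crosses_sphere_twice[OF assms(2-4) C1 assms(5) graph[unfolded p_def] e0]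
    unfolding p_def by metis
  have nq: "norm ((q1 - p) / e) = r" "norm (- ((q2 - p) / e)) = r"
    using q e by (auto simp: norm_divide dist_norm norm_minus_commute)
  define \<theta>1 where "\<theta>1 = Arg ((q1 - p) / e)"
  \<comment> \<open>Reflecting the left point through the origin puts its argument in
    \<open>{- pi / 2<..<pi / 2}\<close>; adding \<open>pi\<close> lands in the required range, away
    from the branch cut of \<open>Arg\<close>.\<close>
  define \<theta>2 where "\<theta>2 = pi + Arg (- ((q2 - p) / e))"
  have \<theta>1: "(q1 - p) / e = rcis r \<theta>1" "- pi / 2 < \<theta>1" "\<theta>1 < pi / 2"
    unfolding \<theta>1_def using Arg_polar[OF q1 nq(1)] by blast+
  have \<theta>2': "- ((q2 - p) / e) = rcis r (\<theta>2 - pi)" "pi / 2 < \<theta>2" "\<theta>2 < 3 * pi / 2"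
    using Arg_polar[of "- ((q2 - p) / e)" r] q2 nq(2) by (auto simp: \<theta>2_def)
  have "rcis r (\<theta>2 - pi) = - rcis r \<theta>2"
    by (simp add: complex_eq_iff cos_diff sin_diff)
  with \<theta>2'(1) have \<theta>2: "(q2 - p) / e = rcis r \<theta>2"
    by (simp only: neg_equal_iff_equal)
  have q12: "q1 = p + e * rcis r \<theta>1" "q2 = p + e * rcis r \<theta>2"
    using e0 by (simp_all flip: \<theta>1(1) \<theta>2)
  define \<phi> where "\<phi> = Arg e"
  have e_rcis: "e * rcis r \<theta> = rcis r (\<theta> + \<phi>)" for \<theta>
    using e rcis_cmod_Arg[of e] rcis_mult[of 1 \<phi> r \<theta>] by (simp add: \<phi>_def add.commute)
  define c where "c = (\<lambda>\<theta>. p + e * rcis r \<theta>)"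
  have c_sphere: "c \<theta> \<in> sphere p r" for \<theta>
    using e assms(3) by (simp add: c_def dist_norm norm_mult)
  have off: "c \<theta> \<notin> frontier \<Omega>" if "(\<theta>1 < \<theta> \<and> \<theta> < \<theta>2) \<or> (\<theta>2 < \<theta> \<and> \<theta> < \<theta>1 + 2 * pi)" for \<theta>
  proof -
    have "rcis r \<theta> \<noteq> rcis r \<theta>1"
      using that \<theta>1 \<theta>2' by (intro rcis_neq_between assms(3)) auto
    moreover have "rcis r \<theta> \<noteq> rcis r \<theta>2"
      using that \<theta>1 \<theta>2' rcis_neq_between[OF assms(3), of \<theta> \<theta>2] rcis_neq_between[OF assms(3), of \<theta>2 \<theta>]
      by auto
    ultimately have "c \<theta> \<notin> {q1, q2}"
      using e0 by (simp add: c_def q12)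
    then show ?thesis
      using q c_sphere[of \<theta>] by blast
  qed
  have cont: "continuous_on S c" for S
    unfolding c_def rcis_def cis_conv_exp by (intro continuous_intros)
  \<comment> \<open>The angles \<open>pi / 2\<close> and \<open>3 * pi / 2\<close> lie in the two
    complementary open arcs, so these points decide the side of each arc.\<close>
  have top: "c (pi / 2) \<in> \<Omega>" and bot: "c (3 * pi / 2) \<notin> \<Omega>"
  proof -
    have "3 * pi / 2 = pi + pi / 2"
      by simp
    then have "cos (3 * pi / 2) = 0" "sin (3 * pi / 2) = - 1"
      by (simp_all only: cos_add sin_add) simp_all
    then have "rcis r (pi / 2) = Complex 0 r" "rcis r (3 * pi / 2) = Complex 0 (- r)"
      by (simp_all add: complex_eq_iff)
    then show "c (pi / 2) \<in> \<Omega>" "c (3 * pi / 2) \<notin> \<Omega>"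
      using sides by (simp_all add: c_def)
  qed
  have ins: "c \<theta> \<in> interior \<Omega>" if "\<theta>1 < \<theta>" "\<theta> < \<theta>2" for \<theta>
  proof -
    have "c \<theta> \<in> \<Omega>"
      using connected_path_same_side[of "{\<theta>1<..<\<theta>2}" c \<Omega> "pi / 2" \<theta>] off that top cont \<theta>1 \<theta>2' by auto
    then show ?thesis
      using off[of \<theta>] that closure_subset by (auto simp: frontier_def)
  qed
  have outs: "c \<theta> \<notin> \<Omega>" if "\<theta>2 < \<theta>" "\<theta> < \<theta>1 + 2 * pi" for \<theta>
    using connected_path_same_side[of "{\<theta>2<..<\<theta>1 + 2 * pi}" c \<Omega> "3 * pi / 2" \<theta>] off that bot cont \<theta>1 \<theta>2'
    by auto
  have c_rcis: "c \<theta> = p + rcis r (\<theta> + \<phi>)" for \<theta>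
    by (simp add: c_def e_rcis)
  \<comment> \<open>Passing from the graph coordinates to the standard axes adds
    \<open>\<phi>\<close>, the argument of \<open>e\<close>, to every angle and leaves differences
    unchanged.\<close>
  have "((\<lambda>\<rho>. measure lebesgue (\<Omega> \<inter> cball p \<rho>)) has_real_derivative ((\<theta>2 + \<phi>) - (\<theta>1 + \<phi>)) * r) (at r)"
  proof (rule area_Int_cball_has_real_derivative[OF assms(1,3)])
    show "p + rcis r \<theta> \<in> interior \<Omega>" if "\<theta>1 + \<phi> < \<theta>" "\<theta> < \<theta>2 + \<phi>" for \<theta>
      using ins[of "\<theta> - \<phi>"] that by (simp add: c_rcis)
    show "p + rcis r \<theta> \<notin> \<Omega>" if "\<theta>2 + \<phi> < \<theta>" "\<theta> < \<theta>1 + \<phi> + 2 * pi" for \<theta>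
      using outs[of "\<theta> - \<phi>"] that by (simp add: c_rcis)
  qed (use \<theta>1 \<theta>2' in auto)
  then have deriv: "((\<lambda>\<rho>. disk_area \<Omega> \<gamma> s \<rho>) has_real_derivative (\<theta>2 - \<theta>1) * r) (at r)"
    by (simp add: disk_area_def p_def)
  have "sphere p r \<inter> \<Omega> = {p + rcis r \<theta> | \<theta>. \<theta>1 + \<phi> \<le> \<theta> \<and> \<theta> \<le> \<theta>2 + \<phi>}"
  proof (intro equalityI subsetI)
    fix z assume z: "z \<in> sphere p r \<inter> \<Omega>"
    obtain \<theta> where \<theta>: "z = p + rcis (dist p z) \<theta>" "\<theta>1 + \<phi> \<le> \<theta>" "\<theta> < \<theta>1 + \<phi> + 2 * pi"
      by (rule polar_coordinates_from)
    have "z = c (\<theta> - \<phi>)"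
      using z \<theta>(1) by (simp add: c_rcis)
    then have "\<theta> \<le> \<theta>2 + \<phi>"
      using outs[of "\<theta> - \<phi>"] z \<theta> by force
    then show "z \<in> {p + rcis r \<theta> | \<theta>. \<theta>1 + \<phi> \<le> \<theta> \<and> \<theta> \<le> \<theta>2 + \<phi>}"
      using z \<theta> by auto
  next
    fix z assume "z \<in> {p + rcis r \<theta> | \<theta>. \<theta>1 + \<phi> \<le> \<theta> \<and> \<theta> \<le> \<theta>2 + \<phi>}"
    then obtain \<theta> where \<theta>: "z = p + rcis r \<theta>" "\<theta>1 + \<phi> \<le> \<theta>" "\<theta> \<le> \<theta>2 + \<phi>"
      by blast
    then have zc: "z = c (\<theta> - \<phi>)"
      by (simp add: c_rcis)
    \<comment> \<open>The end points are on the frontier and belong to \<open>\<Omega>\<close>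
      because it is closed; this makes the arc closed.\<close>
    have "q1 \<in> \<Omega>" "q2 \<in> \<Omega>"
      using q closed frontier_subset_closed by blast+
    then have "c \<theta>1 \<in> \<Omega>" "c \<theta>2 \<in> \<Omega>"
      by (simp_all add: q12 c_def)
    then have "z \<in> \<Omega>"
      using ins[of "\<theta> - \<phi>"] \<theta> interior_subset zc
      by (cases "\<theta> - \<phi> = \<theta>1 \<or> \<theta> - \<phi> = \<theta>2") force+
    with c_sphere zc show "z \<in> sphere p r \<inter> \<Omega>"
      by simp
  qed
  moreover have "has_curve_length {p + rcis r \<theta> | \<theta>. \<theta>1 + \<phi> \<le> \<theta> \<and> \<theta> \<le> \<theta>2 + \<phi>}
      (((\<theta>2 + \<phi>) - (\<theta>1 + \<phi>)) * r)"
    using \<theta>1 \<theta>2' by (intro has_curve_length_circular_arc assms(3)) auto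
  ultimately have "has_curve_length (sphere p r \<inter> \<Omega>) ((\<theta>2 - \<theta>1) * r)"
    by simp
  then show ?thesis
    using \<theta>1 \<theta>2' q deriv unfolding q12 p_def
    by (intro exI[of _ \<theta>1] exI[of _ \<theta>2]) auto
qed

end
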